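(* Let $\omega$ be a factor of the Fibonacci sequence $F_\infty$ with $\omega\notin\{\varepsilon,ab,ba,aba\}$, let $sk(\omega)=s_k$, and let $\omega=\mu_1(\omega)\,s_k\,\mu_2(\omega)$ be its singular decomposition. Then for every $p\ge 1$: (1) $\omega_p=\mu_1(\omega)\, s_{k,p}\,\mu_2(\omega)$; that is, if $\omega_p$ occupies the positions $j+1,\dots,j+|\omega|$ of $F_\infty$, then the block of $F_\infty$ at positions $j+|\mu_1(\omega)|+1,\dots,j+|\mu_1(\omega)|+|s_k|$ is the $p$-th occurrence $s_{k,p}$ of $s_k$ in $F_\infty$; (2) $\nu_{\omega,p}=\mu_2(\omega)^{-1}\,\nu_{s_k,p}\,\mu_1(\omega)^{-1}$ (in the free group on $a,b$). Both decompositions are unique, in the sense that $(\mu_1(\omega),\mu_2(\omega))$ is the only pair of words with $\omega=\mu_1(\omega)\,s_k\,\mu_2(\omega)$.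
   Context: Words are over $\{a,b\}$ and are regarded as elements of the free group on $a,b$; $\varepsilon$ is the empty word. Let $\sigma(a)=ab$, $\sigma(b)=a$, $F_k=\sigma^k(a)$ for $k\ge 0$, and $F_\infty=x_1x_2\cdots=\lim_{k\to\infty}F_k$ (Fibonacci sequence). For $k\ge0$ let $\alpha$ be the last letter of $F_k$ and $\beta$ the other letter. The singular words are $s_{-1}=a$ and $s_k=\beta F_k\alpha^{-1}$ for $k\ge0$ (delete the last letter of $F_k$ and prepend $\beta$). The singular kernel $sk(\omega)$ is the longest singular word that is a factor of $\omega$; for a factor $\omega\notin\{\varepsilon,ab,ba,aba\}$ of $F_\infty$ it is well defined and occurs exactly once in $\omega$, so that $\omega=\mu_1(\omega)\,sk(\omega)\,\mu_2(\omega)$ for uniquely determined words $\mu_1(\omega),\mu_2(\omega)$ (the singular decomposition). Every nonempty factor $\omega$ of $F_\infty$ occurs infinitely often; $\omega_p$ denotes its $p$-th occurrence ($p\ge1$, ordered by position), and $s_{k,p}$ is the $p$-th occurrence of $s_k$. If $\omega_p=x_{i+1}\cdots x_{i+n}$ and $\omega_{p+1}=x_{j+1}\cdots x_{j+n}$ (as positioned blocks), the gap $\nu_{\omega,p}$ is $\varepsilon$ if $i+n=j$; it is the word $x_{i+n+1}\cdots x_j$ if $i+n<j$; and it is the inverse $(x_{j+1}\cdots x_{i+n})^{-1}$ of the overlap if $i+n>j$. *)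

theory Defs
  imports Complex_Main "HOL-Library.Sublist" "HOL-Library.Infinite_Set" "HOL-Algebra.Group"
begin

section \<open>The free group\<close>

text \<open>The free group on the generators of type \<open>'a\<close> is realised by reduced words: the pair
  \<open>(x, True)\<close> stands for the generator \<open>x\<close> and \<open>(x, False)\<close> for its inverse.\<close>

type_synonym 'a signed_word = "('a \<times> bool) list"

definition flip :: "'a \<times> bool \<Rightarrow> 'a \<times> bool" where
  "flip z = (fst z, \<not> snd z)"

fun reduced :: "'a signed_word \<Rightarrow> bool" where
  "reduced [] = True"
| "reduced [z] = True"
| "reduced (y # z # w) = (z \<noteq> flip y \<and> reduced (z # w))"

fun rcons :: "'a \<times> bool \<Rightarrow> 'a signed_word \<Rightarrow> 'a signed_word" where
  "rcons y [] = [y]"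
| "rcons y (z # w) = (if z = flip y then w else y # z # w)"

definition free_group :: "'a signed_word monoid" where
  "free_group = \<lparr>carrier = {w. reduced w}, mult = (\<lambda>u v. foldr rcons u v), one = []\<rparr>"

lemma flip_flip [simp]: "flip (flip z) = z"
  by (simp add: flip_def)

lemma flip_neq [simp]: "flip z \<noteq> z" "z \<noteq> flip z"
  by (cases z; simp add: flip_def)+

lemma reduced_tl: "reduced (z # w) \<Longrightarrow> reduced w"
  by (cases w) auto

lemma reduced_rcons: "reduced w \<Longrightarrow> reduced (rcons z w)"
  by (cases w) (auto dest: reduced_tl)

lemma reduced_foldr: "reduced w \<Longrightarrow> reduced (foldr rcons u w)"
  by (induction u) (auto intro: reduced_rcons)

lemma rcons_flip: "reduced w \<Longrightarrow> rcons z (rcons (flip z) w) = w"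
  by (cases w rule: reduced.cases) auto

lemma rcons_Cons: "reduced (z # w) \<Longrightarrow> rcons z w = z # w"
  by (cases w) auto

lemma foldr_rcons_rcons:
  assumes "reduced t" "reduced w"
  shows "foldr rcons (rcons z t) w = rcons z (foldr rcons t w)"
proof (cases t)
  case (Cons y ys)
  then show ?thesis
    using rcons_flip[OF reduced_foldr[OF assms(2)], of z ys] by auto
qed simp

lemma foldr_rcons_assoc:
  assumes "reduced v" "reduced w"
  shows "foldr rcons (foldr rcons u v) w = foldr rcons u (foldr rcons v w)"
  by (induction u) (simp_all add: foldr_rcons_rcons reduced_foldr assms)

lemma foldr_rcons_Nil: "reduced u \<Longrightarrow> foldr rcons u [] = u"
proof (induction u)
  case (Cons z u)
  then show ?case
    using rcons_Cons[of z u] reduced_tl[of z u] by simp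
qed simp

lemma foldr_rcons_inverse:
  "reduced w \<Longrightarrow> foldr rcons (rev (map flip u)) (foldr rcons u w) = w"
proof (induction u arbitrary: w)
  case (Cons z u)
  have "rcons (flip z) (rcons z (foldr rcons u w)) = foldr rcons u w"
    using rcons_flip[OF reduced_foldr[OF Cons.prems], of "flip z" u] by simp
  then show ?case
    using Cons by simp
qed simp

theorem group_free_group: "group free_group"
proof (rule groupI)
  fix u :: "'a signed_word"
  assume u: "u \<in> carrier free_group"
  define v where "v = foldr rcons (rev (map flip u)) []"
  have "foldr rcons v u = foldr rcons (rev (map flip u)) u"
    using u by (simp add: v_def foldr_rcons_assoc free_group_def)
  also have "\<dots> = []"
    using u foldr_rcons_inverse[of "[]" u] by (simp add: foldr_rcons_Nil free_group_def)
  finally show "\<exists>v\<in>carrier free_group. v \<otimes>\<^bsub>free_group\<^esub> u = \<one>\<^bsub>free_group\<^esub>"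
    by (intro bexI[of _ v]) (simp_all add: free_group_def v_def reduced_foldr)
qed (simp_all add: free_group_def reduced_foldr foldr_rcons_assoc)

definition of_word :: "'a list \<Rightarrow> 'a signed_word" where
  "of_word w = map (\<lambda>x. (x, True)) w"

lemma of_word_carrier: "of_word w \<in> carrier free_group"
  by (induction w rule: induct_list012) (auto simp: of_word_def free_group_def flip_def)

lemma of_word_append: "of_word (u @ v) = of_word u \<otimes>\<^bsub>free_group\<^esub> of_word v"
proof (induction u)
  case (Cons x u)
  have "reduced (of_word (x # u @ v))"
    using of_word_carrier[of "x # u @ v"] by (simp add: free_group_def)
  then show ?case
    using Cons rcons_Cons[of "(x, True)" "of_word (u @ v)"]
    by (simp add: of_word_def free_group_def)
qed (simp add: of_word_def free_group_def)


section \<open>The Fibonacci sequence\<close>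

datatype letter = La | Lb

fun other :: "letter \<Rightarrow> letter" where
  "other La = Lb"
| "other Lb = La"

fun sigma_letter :: "letter \<Rightarrow> letter list" where
  "sigma_letter La = [La, Lb]"
| "sigma_letter Lb = [La]"

definition sigma :: "letter list \<Rightarrow> letter list" where
  "sigma w = concat (map sigma_letter w)"

definition fib_word :: "nat \<Rightarrow> letter list" where
  "fib_word k = (sigma ^^ k) [La]"

text \<open>The limit of the words \<open>fib_word k\<close>, letter by letter. Positions start at 0, so \<open>fib_seq i\<close> is
  \<open>x\<^sub>i\<^sub>+\<^sub>1\<close> and \<open>block i n\<close> is \<open>x\<^sub>i\<^sub>+\<^sub>1 \<dots> x\<^sub>i\<^sub>+\<^sub>n\<close>.\<close>

definition fib_seq :: "nat \<Rightarrow> letter" where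
  "fib_seq i = (THE c. \<forall>\<^sub>F k in sequentially. i < length (fib_word k) \<and> fib_word k ! i = c)"

definition block :: "nat \<Rightarrow> nat \<Rightarrow> letter list" where
  "block i n = map fib_seq [i..<i + n]"

definition occurrences :: "letter list \<Rightarrow> nat set" where
  "occurrences w = {i. block i (length w) = w}"

definition fib_factor :: "letter list \<Rightarrow> bool" where
  "fib_factor w \<longleftrightarrow> occurrences w \<noteq> {}"

text \<open>The \<open>p\<close>-th occurrence (\<open>p \<ge> 1\<close>) is represented by its offset \<open>i\<close>: it is \<open>x\<^sub>i\<^sub>+\<^sub>1 \<dots> x\<^sub>i\<^sub>+\<^sub>n\<close>.\<close>

definition occ :: "letter list \<Rightarrow> nat \<Rightarrow> nat" where
  "occ w p = enumerate (occurrences w) (p - 1)"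

definition gap :: "letter list \<Rightarrow> nat \<Rightarrow> letter signed_word" where
  "gap w p =
    (let i = occ w p; j = occ w (p + 1); n = length w in
     if i + n = j then \<one>\<^bsub>free_group\<^esub>
     else if i + n < j then of_word (block (i + n) (j - (i + n)))
     else inv\<^bsub>free_group\<^esub> (of_word (block j (i + n - j))))"

lemma sigma_append: "sigma (u @ v) = sigma u @ sigma v"
  by (simp add: sigma_def)

lemma sigma_pow_append: "(sigma ^^ k) (u @ v) = (sigma ^^ k) u @ (sigma ^^ k) v"
  by (induction k) (simp_all add: sigma_append)

lemma fib_word_Suc: "fib_word (Suc k) = fib_word k @ (sigma ^^ k) [Lb]"
proof -
  have "fib_word (Suc k) = (sigma ^^ k) ([La] @ [Lb])"
    by (simp add: fib_word_def funpow_swap1 sigma_def)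
  then show ?thesis
    unfolding sigma_pow_append by (simp add: fib_word_def)
qed

lemma prefix_fib_word: "k \<le> l \<Longrightarrow> prefix (fib_word k) (fib_word l)"
  by (induction l rule: dec_induct) (auto simp: fib_word_Suc intro: prefix_order.trans)

lemma sigma_pow_neq_Nil: "w \<noteq> [] \<Longrightarrow> (sigma ^^ k) w \<noteq> []"
proof (induction k)
  case (Suc k)
  then obtain c u where "(sigma ^^ k) w = c # u"
    by (cases "(sigma ^^ k) w") auto
  then have "(sigma ^^ Suc k) w = sigma_letter c @ sigma u"
    by (simp add: sigma_def)
  then show ?case
    by (cases c) simp_all
qed simp

lemma length_fib_word_gt: "k < length (fib_word k)"
proof (induction k)
  case (Suc k)
  moreover have "length ((sigma ^^ k) [Lb]) > 0"
    using sigma_pow_neq_Nil[of "[Lb]" k] by simp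
  ultimately show ?case
    by (simp only: fib_word_Suc length_append)
qed (simp add: fib_word_def)

lemma fib_seq_eq:
  assumes "i < length (fib_word k)"
  shows "fib_seq i = fib_word k ! i"
proof -
  have ev: "\<forall>\<^sub>F l in sequentially. i < length (fib_word l) \<and> fib_word l ! i = fib_word k ! i"
    using eventually_ge_at_top[of k]
  proof eventually_elim
    case (elim l)
    then obtain v where "fib_word l = fib_word k @ v"
      using prefix_fib_word by (metis prefixE)
    then show ?case
      using assms by (simp add: nth_append)
  qed
  show ?thesis
    unfolding fib_seq_def
  proof (rule the_equality)
    show "\<forall>\<^sub>F l in sequentially. i < length (fib_word l) \<and> fib_word l ! i = fib_word k ! i"
      by (rule ev)
  next
    fix c
    assume "\<forall>\<^sub>F l in sequentially. i < length (fib_word l) \<and> fib_word l ! i = c"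
    with ev have "\<forall>\<^sub>F l in sequentially. c = fib_word k ! i"
      by eventually_elim auto
    then show "c = fib_word k ! i"
      by simp
  qed
qed

lemma fib_word_Suc_Suc: "fib_word (Suc (Suc k)) = fib_word (Suc k) @ fib_word k"
  using sigma_pow_append[of k "[La, Lb]" "[La]"]
  by (simp add: fib_word_def funpow_swap1 sigma_def)

lemma block_eqI:
  assumes "i + n \<le> length (fib_word k)"
  shows "block i n = take n (drop i (fib_word k))"
  using assms by (auto simp: block_def fib_seq_eq intro!: nth_equalityI)

text \<open>Hence \<open>occ w p\<close> is meaningful for every factor \<open>w\<close> and every \<open>p \<ge> 1\<close>.\<close>

lemma infinite_occurrences:
  assumes "fib_factor w"
  shows "infinite (occurrences w)"
  unfolding infinite_nat_iff_unbounded_le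
proof
  fix N
  obtain i where i: "block i (length w) = w"
    using assms by (auto simp: fib_factor_def occurrences_def)
  define l where "l = N + i + length w"
  define j where "j = length (fib_word (Suc l))"
  have l: "i + length w \<le> length (fib_word l)"
    using length_fib_word_gt[of l] by (simp add: l_def)
  have "block (j + i) (length w) = take (length w) (drop (j + i) (fib_word (Suc (Suc l))))"
    by (rule block_eqI) (use l in \<open>simp add: fib_word_Suc_Suc j_def\<close>)
  also have "\<dots> = block i (length w)"
    using block_eqI[OF l] by (simp add: fib_word_Suc_Suc j_def)
  finally have "j + i \<in> occurrences w"
    using i by (simp add: occurrences_def)
  moreover have "N \<le> j + i"
    using length_fib_word_gt[of "Suc l"] by (simp add: j_def l_def)
  ultimately show "\<exists>n\<ge>N. n \<in> occurrences w"
    by blast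
qed


section \<open>Singular words and the singular decomposition\<close>

text \<open>Only the indices \<open>k \<ge> -1\<close> are meaningful.\<close>

definition sing :: "int \<Rightarrow> letter list" where
  "sing k =
    (if k < 0 then [La]
     else other (last (fib_word (nat k))) # butlast (fib_word (nat k)))"

definition singular_words :: "letter list set" where
  "singular_words = {sing k | k. k \<ge> -1}"

definition sk :: "letter list \<Rightarrow> letter list" where
  "sk w = (ARG_MAX length s. s \<in> singular_words \<and> sublist s w)"

definition mu1 :: "letter list \<Rightarrow> letter list" where
  "mu1 w = (THE u. \<exists>v. w = u @ sk w @ v)"

definition mu2 :: "letter list \<Rightarrow> letter list" where
  "mu2 w = (THE v. \<exists>u. w = u @ sk w @ v)"

lemma sk_singular:
  assumes "w \<noteq> []"
  shows "sk w \<in> singular_words \<and> sublist (sk w) w"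
proof -
  let ?P = "\<lambda>s. s \<in> singular_words \<and> sublist s w"
  have "[La] \<in> singular_words"
    unfolding singular_words_def by (auto intro!: exI[of _ "-1"] simp: sing_def)
  moreover have "[Lb] \<in> singular_words"
    unfolding singular_words_def by (auto intro!: exI[of _ 0] simp: sing_def fib_word_def)
  moreover obtain c u where w: "w = c # u"
    using assms by (cases w) auto
  ultimately have "?P [c]"
    by (cases c) (auto simp: sublist_Cons_right)
  moreover have "\<forall>s. ?P s \<longrightarrow> length s < Suc (length w)"
    by (auto simp: less_Suc_eq_le dest: sublist_length_le)
  ultimately show ?thesis
    unfolding sk_def by (rule arg_max_natI)
qed

end

theory Submission
  imports Defs
begin

text \<open>Write \<open>f k\<close> for the length of \<open>F k\<close>. The heart of the matter is to locate every occurrence of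
\<open>s k\<close> in the Fibonacci sequence. Since the sequence is fixed by \<open>\<sigma>\<close>, it is cut by \<open>\<sigma>^k\<close> into blocks:
\<open>\<sigma>^k(a) = F k\<close> for each of its letters \<open>a\<close>, and \<open>\<sigma>^k(b) = F (k-1)\<close> for each \<open>b\<close>. The word \<open>s k\<close> is the
last letter of \<open>\<sigma>^k(b)\<close> followed by \<open>F k\<close> without its last letter. As every \<open>b\<close> is followed by
\<open>a\<close>, it occurs at the end of every \<open>b\<close>-block. It occurs nowhere else
(\<open>sing_occurs_at_b_block\<close>): the word \<open>s (k+2)\<close> starts with \<open>s k\<close>, so this passes from \<open>k\<close> to \<open>k+2\<close>, the only
alternative being excluded because \<open>F k F (k-1)\<close> and \<open>F (k-1) F k\<close> differ exactly in their last two
letters (\<open>near_commute\<close>).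

Around a \<open>b\<close> the sequence reads \<open>a b a\<close>, followed by \<open>b a\<close> or \<open>a b\<close>, and preceded by \<open>a\<close>, by
\<open>b\<close> or by nothing. Reading these patterns as blocks, with near commutation once more, shows that the
\<open>f (k+1) - 1\<close> letters on either side of \<open>s k\<close> are the same at all occurrences, whereas one letter
further on either side completes an \<open>s (k+1)\<close> next to \<open>s k\<close> or an \<open>s (k+2)\<close> that contains it. A word
\<open>u s_k v\<close> with singular kernel \<open>s k\<close> contains neither, so \<open>u\<close> and \<open>v\<close> are shorter than \<open>f (k+1)\<close>
(\<open>extension_bounds\<close>), and every occurrence of \<open>s k\<close> extends to one of \<open>u s_k v\<close>
(\<open>occurrences_of_extension\<close>). The two occurrence sets are therefore translates of each other by
\<open>|u|\<close>, and so are their increasing enumerations. Uniqueness of the decomposition follows because two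
occurrences of \<open>s k\<close> are at least \<open>f (k+1)\<close> apart (\<open>sing_separated\<close>).

For the gaps, in all three cases of the definition the gap equals \<open>w\<^sup>-\<^sup>1 B\<close>, where \<open>B\<close> is the word
read from the start of one occurrence of \<open>w\<close> to the start of the next (\<open>gap_eq\<close>). Translating both
starts by \<open>|u|\<close> conjugates \<open>B\<close> by \<open>u\<close>, which gives the formula.

The argument needs \<open>k \<ge> 0\<close>. For \<open>s_{-1} = a\<close>, the other singular word of length one is the letter
\<open>b\<close>, and the excluded words \<open>ab\<close>, \<open>ba\<close>, \<open>aba\<close> are those where the longest singular factor is
ambiguous; what remains is the word \<open>a\<close> itself (\<open>sk_eq_a_imp_a\<close>).\<close>

section \<open>Prefixes of the Fibonacci sequence\<close>

text \<open>An occurrence of \<open>w\<close> is handled as a word \<open>t\<close> such that \<open>t @ w\<close> is a prefix of the sequence.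
Occurrences can then be moved through \<open>\<sigma>\<close> by applying it to words, with no position arithmetic.\<close>

definition fib_prefix :: "letter list \<Rightarrow> bool" where
  "fib_prefix w \<longleftrightarrow> block 0 (length w) = w"

lemma block_add: "block i (m + n) = block i m @ block (i + m) n"
  unfolding block_def by (metis add.assoc le_add1 map_append upt_add_eq_append)

lemma length_block [simp]: "length (block i n) = n"
  by (simp add: block_def)

lemma fib_prefix_block: "fib_prefix (block 0 n)"
  by (simp add: fib_prefix_def)

lemma fib_prefix_append:
  "fib_prefix (t @ w) \<longleftrightarrow> fib_prefix t \<and> block (length t) (length w) = w"
  by (auto simp: fib_prefix_def block_add)

lemma fib_prefix_appendD: "fib_prefix (t @ w) \<Longrightarrow> fib_prefix t"
  by (simp add: fib_prefix_append)

lemma mem_occurrences_iff: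
  "i \<in> occurrences w \<longleftrightarrow> (\<exists>t. length t = i \<and> fib_prefix (t @ w))"
  by (metis (mono_tags, lifting) mem_Collect_eq occurrences_def fib_prefix_append fib_prefix_block length_block)

lemma fib_prefix_linear:
  "fib_prefix u \<Longrightarrow> fib_prefix v \<Longrightarrow> length u \<le> length v \<Longrightarrow> prefix u v"
  unfolding fib_prefix_def by (metis block_add le_add_diff_inverse prefixI)

lemma fib_prefix_extend: "fib_prefix u \<Longrightarrow> \<exists>c. fib_prefix (u @ [c])"
  by (auto simp: fib_prefix_append block_def)

text \<open>This makes invariance of the set of prefixes under \<open>\<sigma>\<close> visible: \<open>\<sigma>\<close> maps \<open>F k\<close> to \<open>F (k+1)\<close>.\<close>

lemma fib_prefix_iff_prefix_fib_word: "fib_prefix w \<longleftrightarrow> (\<exists>k. prefix w (fib_word k))"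
proof
  assume "fib_prefix w"
  moreover have "block 0 (length w) = take (length w) (fib_word (length w))"
    using block_eqI[of 0 "length w" "length w"] length_fib_word_gt[of "length w"] by simp
  ultimately show "\<exists>k. prefix w (fib_word k)"
    by (metis fib_prefix_def take_is_prefix)
next
  assume "\<exists>k. prefix w (fib_word k)"
  then obtain k v where "fib_word k = w @ v" by (auto elim: prefixE)
  then show "fib_prefix w"
    using block_eqI[of 0 "length w" k] by (simp add: fib_prefix_def)
qed

lemma sigma_simps [simp]:
  "sigma [] = []" "sigma (c # w) = sigma_letter c @ sigma w"
  by (simp_all add: sigma_def)

lemma fib_prefix_sigma: "fib_prefix w \<Longrightarrow> fib_prefix (sigma w)"
proof -
  assume "fib_prefix w"
  then obtain k v where "fib_word k = w @ v"
    by (auto simp: fib_prefix_iff_prefix_fib_word elim: prefixE)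
  then have "fib_word (Suc k) = sigma w @ sigma v"
    by (simp add: fib_word_def sigma_append)
  then show ?thesis
    unfolding fib_prefix_iff_prefix_fib_word by (metis prefixI)
qed

lemma fib_prefix_sigma_pow: "fib_prefix w \<Longrightarrow> fib_prefix ((sigma ^^ k) w)"
  by (induction k) (simp_all add: fib_prefix_sigma)

section \<open>Desubstitution and the local structure of the sequence\<close>

text \<open>A cut through \<open>\<sigma> z\<close> either falls between two letter images or inside an image \<open>ab\<close> of \<open>a\<close>.\<close>

lemma prefix_sigma_cases:
  assumes "prefix w (sigma z)"
  shows "(\<exists>v. prefix v z \<and> w = sigma v) \<or> (\<exists>v. prefix (v @ [La]) z \<and> w = sigma v @ [La])"
  using assms
proof (induction z arbitrary: w)
  case (Cons c z)
  consider "w = []" | "w = [La]" "c = La" | w' where "w = sigma_letter c @ w'" "prefix w' (sigma z)"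
    using Cons.prems by (cases c) (auto simp: prefix_Cons)
  then show ?case
  proof cases
    case 1
    then show ?thesis by (auto intro!: exI[of _ "[]"])
  next
    case 2
    then show ?thesis by (auto intro!: exI[of _ "[]"])
  next
    case 3
    from Cons.IH[OF 3(2)] show ?thesis
    proof (elim disjE exE conjE)
      fix v assume "prefix v z" "w' = sigma v"
      then show ?thesis using 3(1) by (intro disjI1 exI[of _ "c # v"]) auto
    next
      fix v assume "prefix (v @ [La]) z" "w' = sigma v @ [La]"
      then show ?thesis using 3(1) by (intro disjI2 exI[of _ "c # v"]) auto
    qed
  qed
qed (auto intro!: exI[of _ "[]"])

lemma fib_prefix_sigma_cases:
  assumes "fib_prefix w"
  obtains v where "fib_prefix v" "w = sigma v"
  | v where "fib_prefix (v @ [La])" "w = sigma v @ [La]"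
proof -
  obtain k where "prefix w (fib_word k)"
    using assms by (auto simp: fib_prefix_iff_prefix_fib_word)
  moreover have "prefix (fib_word k) (fib_word (Suc k))"
    by (rule prefix_fib_word) simp
  ultimately have "prefix w (sigma (fib_word k))"
    by (metis prefix_order.trans fib_word_def funpow.simps(2) comp_apply)
  from prefix_sigma_cases[OF this] show thesis
    using that fib_prefix_iff_prefix_fib_word by blast
qed

lemma last_sigma_snoc: "sigma (v @ [c]) \<noteq> [] \<and> last (sigma (v @ [c])) = other c"
  by (cases c) (simp_all add: sigma_append)

text \<open>The letter \<open>b\<close> is only produced at the end of \<open>\<sigma>(a) = ab\<close>.\<close>

lemma desubstitute_b:
  assumes "fib_prefix (u @ [Lb])"
  obtains v where "fib_prefix (v @ [La])" "u @ [Lb] = sigma (v @ [La])"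
  using assms
proof (cases rule: fib_prefix_sigma_cases)
  case (1 v)
  then obtain v' c where v: "v = v' @ [c]" by (cases v rule: rev_cases) auto
  with 1 have "other c = Lb" by (metis last_sigma_snoc last_snoc)
  then have "c = La" by (cases c) auto
  with 1 v that show thesis by blast
qed simp

text \<open>Inside \<open>\<sigma>(a) = ab\<close> the letter \<open>a\<close> is followed by \<open>b\<close>, so an \<open>a\<close> followed by \<open>a\<close> is \<open>\<sigma>(b)\<close>.\<close>

lemma desubstitute_aa:
  assumes "fib_prefix (u @ [La, La])"
  obtains v where "fib_prefix (v @ [Lb])" "u @ [La] = sigma (v @ [Lb])"
proof -
  have "fib_prefix (u @ [La])" using assms fib_prefix_appendD[of "u @ [La]" "[La]"] by simp
  then show thesis
  proof (cases rule: fib_prefix_sigma_cases)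
    case (1 v)
    then obtain v' c where v: "v = v' @ [c]" by (cases v rule: rev_cases) auto
    with 1 have "other c = La" by (metis last_sigma_snoc last_snoc)
    then have "c = Lb" by (cases c) auto
    with 1 v that show thesis by blast
  next
    case (2 v)
    from fib_prefix_sigma[OF 2(1)] have "fib_prefix (u @ [La, Lb])"
      using 2(2) by (simp add: sigma_append)
    with assms show thesis
      using fib_prefix_linear by fastforce
  qed
qed

lemma before_b:
  assumes "fib_prefix (u @ [Lb])"
  obtains v where "u = v @ [La]"
proof -
  obtain v where "u @ [Lb] = sigma (v @ [La])" using assms by (rule desubstitute_b)
  then show thesis using that by (auto simp: sigma_append)
qed

lemma after_b:
  assumes "fib_prefix (u @ [Lb, c])"
  shows "c = La"
proof (cases c)
  case Lb
  with assms before_b[of "u @ [Lb]"] show ?thesis by auto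
qed

text \<open>A factor \<open>aaa\<close> would desubstitute to \<open>bb\<close>.\<close>

lemma after_aa:
  assumes "fib_prefix (u @ [La, La, c])"
  shows "c = Lb"
proof (rule ccontr)
  assume "c \<noteq> Lb"
  then have c: "c = La" by (cases c) auto
  obtain v where v: "fib_prefix (v @ [Lb])" "u @ [La, La] = sigma (v @ [Lb])"
    using assms desubstitute_aa[of "u @ [La]"] c by auto
  then have "u @ [La] = sigma v" by (simp add: sigma_append)
  moreover obtain v' where v': "v = v' @ [La]" using v(1) by (rule before_b)
  ultimately show False by (simp add: sigma_append)
qed

section \<open>The blocks of level k\<close>

text \<open>This is \<open>F (k-1)\<close>, with \<open>F (-1) = b\<close>: the block of level \<open>k\<close> that stems from a letter \<open>b\<close>.\<close>

definition fib_pred :: "nat \<Rightarrow> letter list" where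
  "fib_pred k = (sigma ^^ k) [Lb]"

lemma fib_pred_0 [simp]: "fib_pred 0 = [Lb]"
  by (simp add: fib_pred_def)

lemma fib_pred_Suc [simp]: "fib_pred (Suc k) = fib_word k"
  by (simp add: fib_pred_def fib_word_def funpow_swap1)

lemma fib_word_0 [simp]: "fib_word 0 = [La]"
  by (simp add: fib_word_def)

lemma fib_word_Suc' [simp]: "fib_word (Suc k) = fib_word k @ fib_pred k"
  by (simp add: fib_word_Suc fib_pred_def)

lemma sigma_pow_Nil [simp]: "(sigma ^^ k) [] = []"
  by (induction k) simp_all

lemma sigma_pow_Cons [simp]:
  "(sigma ^^ k) (La # w) = fib_word k @ (sigma ^^ k) w"
  "(sigma ^^ k) (Lb # w) = fib_pred k @ (sigma ^^ k) w"
  using sigma_pow_append[of k "[La]" w] sigma_pow_append[of k "[Lb]" w]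
  by (simp_all add: fib_word_def fib_pred_def)

lemma fib_word_neq_Nil [simp]: "fib_word k \<noteq> []" "fib_pred k \<noteq> []"
  unfolding fib_word_def fib_pred_def by (rule sigma_pow_neq_Nil, simp)+

lemma last_fib_pred: "last (fib_pred k) = other (last (fib_word k))"
proof -
  have "last (fib_pred k) \<noteq> last (fib_word k)"
    by (induction k) auto
  then show ?thesis by (cases "last (fib_pred k)"; cases "last (fib_word k)") auto
qed

text \<open>The letter prepended to \<open>F k\<close> is the last letter of \<open>F (k-1)\<close>, the reason why \<open>s k\<close> is found where a
block \<open>F (k-1)\<close> is followed by a block \<open>F k\<close>.\<close>

lemma sing_int: "sing (int k) = last (fib_pred k) # butlast (fib_word k)"
  by (simp add: sing_def last_fib_pred)

lemma length_sing: "length (sing (int k)) = length (fib_word k)"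
  by (simp add: sing_int)

text \<open>The common part is long enough for forced extensions, and the difference of the last two letters is
what tells apart the two continuations of \<open>b\<close> in the sequence.\<close>

lemma near_commute:
  "\<exists>P x y. x \<noteq> y \<and> fib_word k @ fib_pred k = P @ [x, y] \<and> fib_pred k @ fib_word k = P @ [y, x]"
proof (induction k)
  case 0
  have "fib_word 0 @ fib_pred 0 = [] @ [La, Lb]" "fib_pred 0 @ fib_word 0 = [] @ [Lb, La]"
    by simp_all
  then show ?case by blast
next
  case (Suc k)
  then obtain P x y where P: "x \<noteq> y" "fib_word k @ fib_pred k = P @ [x, y]"
    "fib_pred k @ fib_word k = P @ [y, x]" by blast
  have "fib_word (Suc k) @ fib_pred (Suc k) = fib_word k @ (fib_pred k @ fib_word k)"
    "fib_pred (Suc k) @ fib_word (Suc k) = fib_word k @ (fib_word k @ fib_pred k)"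
    by simp_all
  then have *: "fib_word (Suc k) @ fib_pred (Suc k) = (fib_word k @ P) @ [y, x]"
    "fib_pred (Suc k) @ fib_word (Suc k) = (fib_word k @ P) @ [x, y]"
    by (simp_all only: P append.assoc)
  show ?case
    by (rule exI, rule exI, rule exI, rule conjI[OF P(1)[symmetric] conjI[OF *]])
qed

lemma after_b_cases:
  assumes "fib_prefix (v @ [Lb])"
  shows "fib_prefix (v @ [Lb, La, Lb, La]) \<or> fib_prefix (v @ [Lb, La, La, Lb])"
proof -
  obtain c where "fib_prefix (v @ [Lb, c])"
    using fib_prefix_extend[OF assms] by auto
  then have ba: "fib_prefix (v @ [Lb, La])"
    using after_b by blast
  obtain d where d: "fib_prefix (v @ [Lb, La, d])"
    using fib_prefix_extend[OF ba] by auto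
  obtain e where e: "fib_prefix (v @ [Lb, La, d, e])"
    using fib_prefix_extend[OF d] by auto
  show ?thesis
  proof (cases d)
    case La
    then have "e = Lb"
      using after_aa[of "v @ [Lb]" e] e La by simp
    then show ?thesis using e La by blast
  next
    case Lb
    then have "e = La"
      using after_b[of "v @ [Lb, La]" e] e Lb by simp
    then show ?thesis using e Lb by blast
  qed
qed

section \<open>The occurrences of a singular word\<close>

text \<open>In the step, \<open>s (k+2)\<close> begins with \<open>s k\<close> and hence sits at the end of a \<open>b\<close>-block of level \<open>k\<close>.
After this \<open>b\<close> the level-\<open>k\<close> letters are \<open>a b a\<close> or \<open>a a b\<close>. The latter clashes with \<open>s (k+2)\<close>.
In the former, two desubstitutions show that \<open>b\<close> is the last letter of \<open>\<sigma>\<^sup>2(b) = ab\<close>, so that its block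
ends a \<open>b\<close>-block of level \<open>k+2\<close>. The step width is two because the first letter of \<open>s k\<close> depends
on the parity of \<open>k\<close>.\<close>

lemma sing_occurs_at_b_block:
  assumes "fib_prefix (u @ sing (int k))"
  shows "\<exists>v. fib_prefix (v @ [Lb]) \<and> u @ [last (fib_pred k)] = (sigma ^^ k) (v @ [Lb])"
  using assms
proof (induction k arbitrary: u rule: induct_nat_012)
  case 0
  then show ?case by (auto simp: sing_int[of 0, simplified])
next
  case 1
  then have "fib_prefix (u @ [La, La])"
    using sing_int[of "Suc 0"] by simp
  then show ?case by (elim desubstitute_aa) auto
next
  case (ge2 n)
  let ?h = "last (fib_pred n)" and ?A = "fib_word n" and ?B = "fib_pred n"
  have s: "sing (int (Suc (Suc n))) = ?h # ?A @ ?B @ butlast ?A"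
    by (simp only: sing_int) (simp add: butlast_append)
  have "?A = butlast ?A @ [last ?A]" by simp
  with s have "sing (int (Suc (Suc n))) = sing (int n) @ [last ?A] @ ?B @ butlast ?A"
    by (metis sing_int append_Cons append.assoc)
  with ge2.prems have "fib_prefix (u @ sing (int n))"
    using fib_prefix_appendD[of "u @ sing (int n)"] by simp
  from ge2.IH(1)[OF this] obtain v where
    v: "fib_prefix (v @ [Lb])" "u @ [?h] = (sigma ^^ n) (v @ [Lb])" by blast
  from after_b_cases[OF v(1)] show ?case
  proof
    \<comment> \<open>After its first letter and one block \<open>F n\<close>, the occurrence would have to continue with \<open>P y\<close>, but reads \<open>P x\<close>.\<close>
    assume "fib_prefix (v @ [Lb, La, La, Lb])"
    then have "fib_prefix ((sigma ^^ n) ((v @ [Lb]) @ [La, La, Lb]))"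
      by (intro fib_prefix_sigma_pow) simp
    then have 1: "fib_prefix ((u @ ?h # ?A) @ ?A @ ?B)"
      unfolding sigma_pow_append[of n "v @ [Lb]"] v(2)[symmetric] by simp
    obtain P x y where P: "x \<noteq> y" "?A @ ?B = P @ [x, y]" "?B @ ?A = P @ [y, x]"
      using near_commute by blast
    have "?B @ butlast ?A = butlast (?B @ ?A)" by (simp add: butlast_append)
    also have "\<dots> = P @ [y]" unfolding P by (simp add: butlast_append)
    finally have "fib_prefix ((u @ ?h # ?A) @ P @ [y])"
      using ge2.prems s by simp
    moreover have "fib_prefix ((u @ ?h # ?A) @ P @ [x])"
      using 1 fib_prefix_appendD[of "(u @ ?h # ?A) @ P @ [x]" "[y]"] unfolding P by simp
    ultimately have "prefix ((u @ ?h # ?A) @ P @ [y]) ((u @ ?h # ?A) @ P @ [x])"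
      by (rule fib_prefix_linear) simp
    with P(1) show ?thesis by simp
  next
    \<comment> \<open>The factor \<open>bab\<close> comes from \<open>aa\<close>, whose first letter comes from \<open>b\<close>.\<close>
    assume "fib_prefix (v @ [Lb, La, Lb, La])"
    then have "fib_prefix ((v @ [Lb, La]) @ [Lb])"
      using fib_prefix_appendD[of "v @ [Lb, La, Lb]" "[La]"] by simp
    then obtain w where w: "fib_prefix (w @ [La])" "(v @ [Lb, La]) @ [Lb] = sigma (w @ [La])"
      by (rule desubstitute_b)
    then have vw: "v @ [Lb] = sigma w" by (simp add: sigma_append)
    then obtain w' c where w': "w = w' @ [c]" by (cases w rule: rev_cases) auto
    have "c = La" using vw unfolding w' by (cases c) (auto simp: sigma_append)
    with w w' have "fib_prefix (w' @ [La, La])" by simp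
    then obtain z where z: "fib_prefix (z @ [Lb])" "w' @ [La] = sigma (z @ [Lb])"
      by (rule desubstitute_aa)
    have "v @ [Lb] = (sigma ^^ 2) (z @ [Lb])"
      using vw w' \<open>c = La\<close> z(2) by (simp add: numeral_2_eq_2)
    with v(2) have "u @ [?h] = (sigma ^^ (n + 2)) (z @ [Lb])"
      by (simp only: funpow_add comp_apply)
    with z(1) show ?thesis by (intro exI[of _ z]) simp
  qed
qed

lemma sing_Suc: "sing (int k + 1) = last (fib_word k) # butlast (fib_word (Suc k))"
  using sing_int[of "Suc k"] by (simp add: add.commute)

lemma sing_Suc_Suc: "sing (int k + 2) = last (fib_pred k) # butlast (fib_word (Suc (Suc k)))"
  using sing_int[of "Suc (Suc k)"] by (simp add: add.commute)

lemma blocks_after_sing: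
  assumes "fib_prefix (t @ sing (int k))"
  shows "fib_prefix (t @ last (fib_pred k) # fib_word k @ fib_word k @ fib_pred k)
    \<or> fib_prefix (t @ last (fib_pred k) # fib_word (Suc (Suc k)))"
proof -
  obtain v where v: "fib_prefix (v @ [Lb])" "t @ [last (fib_pred k)] = (sigma ^^ k) (v @ [Lb])"
    using sing_occurs_at_b_block[OF assms] by blast
  have "fib_prefix (t @ last (fib_pred k) # (sigma ^^ k) w)" if "fib_prefix (v @ Lb # w)" for w
    using fib_prefix_sigma_pow[OF that, of k] sigma_pow_append[of k "v @ [Lb]" w] v(2)[symmetric]
    by simp
  from after_b_cases[OF v(1)] this[of "[La, Lb, La]"] this[of "[La, La, Lb]"] show ?thesis
    by auto
qed

text \<open>The two cases are the patterns \<open>b a a b\<close> and \<open>b a b a\<close> of level \<open>k\<close>: either \<open>s (k+1)\<close> straddles the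
boundary between two blocks \<open>F k\<close>, or \<open>s (k+2)\<close> starts at the same place as \<open>s k\<close>.\<close>

lemma sing_right:
  assumes "fib_prefix (t @ sing (int k))"
  shows "fib_prefix (t @ sing (int k) @ sing (int k + 1)) \<or> fib_prefix (t @ sing (int k + 2))"
proof -
  have "t @ last (fib_pred k) # fib_word k @ fib_word k @ fib_pred k
      = (t @ sing (int k) @ sing (int k + 1)) @ [last (fib_pred k)]"
  proof -
    have "sing (int k) @ [last (fib_word k)] = last (fib_pred k) # fib_word k"
      by (simp add: sing_int)
    then have "sing (int k) @ sing (int k + 1)
        = last (fib_pred k) # fib_word k @ butlast (fib_word (Suc k))"
      unfolding sing_Suc by (metis append_Cons append.assoc append_Nil)
    moreover have "butlast (fib_word (Suc k)) @ [last (fib_pred k)] = fib_word k @ fib_pred k"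
      by (simp add: butlast_append)
    ultimately show ?thesis by simp
  qed
  moreover have "t @ last (fib_pred k) # fib_word (Suc (Suc k))
      = (t @ sing (int k + 2)) @ [last (fib_word k)]"
    by (simp add: sing_Suc_Suc butlast_append)
  ultimately show ?thesis
    using blocks_after_sing[OF assms] fib_prefix_appendD by metis
qed

text \<open>By near commutation both patterns on the right of \<open>s k\<close> agree on the word \<open>Q\<close> below, which reaches
\<open>f (k+1) - 1\<close> letters beyond \<open>s k\<close>.\<close>

lemma right_extension_forced:
  assumes "fib_prefix (t @ sing (int k) @ v)" "length v < length (fib_word (Suc k))"
    and "fib_prefix (t' @ sing (int k))"
  shows "fib_prefix (t' @ sing (int k) @ v)"
proof -
  obtain P x y where P: "fib_word k @ fib_pred k = P @ [x, y]" "fib_pred k @ fib_word k = P @ [y, x]"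
    using near_commute by blast
  define Q where "Q = last (fib_pred k) # fib_word k @ P"
  have "fib_word (Suc (Suc k)) = fib_word k @ (fib_pred k @ fib_word k)"
    by simp
  then have W: "fib_word (Suc (Suc k)) = fib_word k @ P @ [y, x]"
    unfolding P .
  have Q: "fib_prefix (s @ Q)" if "fib_prefix (s @ sing (int k))" for s
  proof -
    have "fib_prefix ((s @ Q) @ [x, y]) \<or> fib_prefix ((s @ Q) @ [y, x])"
      using blocks_after_sing[OF that] unfolding P W Q_def by simp
    then show ?thesis
      using fib_prefix_appendD by blast
  qed
  have "length (fib_word (Suc k)) = length P + 2"
    using arg_cong[OF P(1), of length] by simp
  then have "length (sing (int k) @ v) \<le> length Q"
    using assms(2) by (simp add: length_sing Q_def)
  then have "prefix (t @ sing (int k) @ v) (t @ Q)"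
    using assms(1) fib_prefix_appendD[of "t @ sing (int k)" v] by (intro fib_prefix_linear Q) auto
  then obtain z where "Q = (sing (int k) @ v) @ z"
    by (auto elim: prefixE)
  then show ?thesis
    using Q[OF assms(3)] fib_prefix_appendD[of "t' @ sing (int k) @ v" z] by simp
qed

text \<open>The \<open>b\<close>-block at the end of which \<open>s k\<close> starts is preceded by an \<open>a\<close>-block, and the two make up
\<open>F (k+1)\<close>; its last letter is the first one of \<open>s k\<close>. This is the forced extension on the left. In
front of it comes nothing, an \<open>a\<close>-block, whose last letter completes \<open>s (k+1)\<close>, or a \<open>b\<close>-block, whose
last letter starts an occurrence of \<open>s (k+2)\<close> that ends together with \<open>s k\<close>.\<close>

lemma sing_left:
  assumes "fib_prefix (t @ sing (int k))"
  shows "t = butlast (fib_word (Suc k)) \<or> (\<exists>t'. t = t' @ sing (int k + 1))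
    \<or> (\<exists>t'. t @ sing (int k) = t' @ sing (int k + 2))"
    and "\<exists>t'. t = t' @ butlast (fib_word (Suc k))"
proof -
  let ?h = "last (fib_pred k)" and ?A = "fib_word k" and ?B = "fib_pred k"
  obtain v where v: "fib_prefix (v @ [Lb])" "t @ [?h] = (sigma ^^ k) (v @ [Lb])"
    using sing_occurs_at_b_block[OF assms] by blast
  then obtain v' where v': "v = v' @ [La]"
    using before_b by blast
  have "t @ [?h] = (sigma ^^ k) v' @ ?A @ ?B"
    using v(2) by (simp add: v' sigma_pow_append)
  then have t: "t = (sigma ^^ k) v' @ butlast (fib_word (Suc k))"
    by (metis butlast_append butlast_snoc fib_word_Suc' fib_word_neq_Nil(1))
  then show "\<exists>t'. t = t' @ butlast (fib_word (Suc k))" by blast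
  show "t = butlast (fib_word (Suc k)) \<or> (\<exists>t'. t = t' @ sing (int k + 1))
    \<or> (\<exists>t'. t @ sing (int k) = t' @ sing (int k + 2))"
  proof (cases v' rule: rev_cases)
    case Nil
    then show ?thesis using t by simp
  next
    case (snoc v'' c)
    show ?thesis
    proof (cases c)
      case La
      have "(sigma ^^ k) v' = ((sigma ^^ k) v'' @ butlast ?A) @ [last ?A]"
        by (simp add: snoc La sigma_pow_append)
      then have "t = ((sigma ^^ k) v'' @ butlast ?A) @ sing (int k + 1)"
        unfolding t sing_Suc by simp
      then show ?thesis by blast
    next
      case Lb
      have B: "(sigma ^^ k) v' = ((sigma ^^ k) v'' @ butlast ?B) @ [?h]"
        by (simp add: snoc Lb sigma_pow_append)
      have "t @ sing (int k) = (t @ [?h]) @ butlast ?A"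
        by (simp add: sing_int)
      also have "\<dots> = (sigma ^^ k) v' @ butlast (fib_word (Suc (Suc k)))"
        unfolding t by (simp add: butlast_append)
      also have "\<dots> = ((sigma ^^ k) v'' @ butlast ?B) @ sing (int k + 2)"
        unfolding B sing_Suc_Suc by simp
      finally show ?thesis by blast
    qed
  qed
qed

text \<open>Two letters \<open>b\<close> have an \<open>a\<close> between them, so the ends of two distinct \<open>b\<close>-blocks are separated by at least
\<open>f k\<close> plus the length of the second \<open>b\<close>-block.\<close>

lemma sing_separated:
  assumes "fib_prefix (t @ sing (int k))" "fib_prefix (t' @ sing (int k))" "length t < length t'"
  shows "length t + length (fib_word (Suc k)) \<le> length t'"
proof -
  let ?h = "last (fib_pred k)"
  obtain v where v: "fib_prefix (v @ [Lb])" "t @ [?h] = (sigma ^^ k) (v @ [Lb])"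
    using sing_occurs_at_b_block[OF assms(1)] by blast
  obtain v' where v': "fib_prefix (v' @ [Lb])" "t' @ [?h] = (sigma ^^ k) (v' @ [Lb])"
    using sing_occurs_at_b_block[OF assms(2)] by blast
  have "\<not> prefix (v' @ [Lb]) (v @ [Lb])"
  proof
    assume "prefix (v' @ [Lb]) (v @ [Lb])"
    then obtain z where "v @ [Lb] = (v' @ [Lb]) @ z" by (auto elim: prefixE)
    then have "t @ [?h] = t' @ [?h] @ (sigma ^^ k) z"
      by (metis v(2) v'(2) sigma_pow_append append.assoc)
    from arg_cong[OF this, of length] show False
      using assms(3) by simp
  qed
  then have "\<not> length (v' @ [Lb]) \<le> length (v @ [Lb])"
    using fib_prefix_linear[OF v'(1) v(1)] by blast
  then have "prefix (v @ [Lb]) (v' @ [Lb])" "v \<noteq> v'"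
    using fib_prefix_linear[OF v(1) v'(1)] by auto
  then obtain z where z: "v' @ [Lb] = v @ Lb # z" "z \<noteq> []" by (auto elim: prefixE)
  obtain c z' where cz: "z = c # z'" using z by (cases z) auto
  have "c = La"
    using v'(1) z cz fib_prefix_appendD[of "v @ [Lb, c]" z'] after_b[of v c] by simp
  obtain z'' where z'': "z' = z'' @ [Lb]"
    using z(1) cz \<open>c = La\<close> by (cases z' rule: rev_cases) auto
  have "t' @ [?h] = (sigma ^^ k) ((v @ [Lb]) @ La # z'' @ [Lb])"
    using v'(2) z(1) cz z'' \<open>c = La\<close> by simp
  also have "\<dots> = t @ [?h] @ fib_word k @ (sigma ^^ k) z'' @ fib_pred k"
    unfolding sigma_pow_append[of k "v @ [Lb]"] v(2)[symmetric] by (simp add: sigma_pow_append)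
  finally have "t' @ [?h] = t @ [?h] @ fib_word k @ (sigma ^^ k) z'' @ fib_pred k" .
  from arg_cong[OF this, of length] show ?thesis by simp
qed

section \<open>Words around a singular word\<close>

text \<open>If \<open>u\<close> had length \<open>f (k+1)\<close> or more, it would end with the \<open>s (k+1)\<close>, or \<open>u @ s k\<close> with the \<open>s (k+2)\<close>,
that is bound to appear on the left of \<open>s k\<close>. The same holds on the right.\<close>

lemma extension_bounds:
  assumes "fib_prefix (t @ u @ sing (int k) @ v)"
    and "\<not> sublist (sing (int k + 1)) (u @ sing (int k) @ v)"
    and "\<not> sublist (sing (int k + 2)) (u @ sing (int k) @ v)"
  shows "length u < length (fib_word (Suc k))" "length v < length (fib_word (Suc k))"
proof -
  have l1: "length (sing (int k + 1)) = length (fib_word (Suc k))"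
    and l2: "length (sing (int k + 2)) = length (fib_word k) + length (fib_word (Suc k))"
    by (simp_all add: sing_Suc sing_Suc_Suc)
  have tu: "fib_prefix ((t @ u) @ sing (int k))"
    using assms(1) fib_prefix_appendD[of "t @ u @ sing (int k)" v] by simp
  show "length u < length (fib_word (Suc k))"
  proof (rule ccontr)
    assume long: "\<not> length u < length (fib_word (Suc k))"
    from sing_left(1)[OF tu] show False
    proof (elim disjE exE)
      assume *: "t @ u = butlast (fib_word (Suc k))"
      have "length (fib_word (Suc k)) > 0" by simp
      then show False
        using long arg_cong[OF *, of length] unfolding length_append length_butlast by linarith
    next
      fix t' assume *: "t @ u = t' @ sing (int k + 1)"
      have "suffix (sing (int k + 1)) (t @ u)" "suffix u (t @ u)"
        by (rule suffixI[OF *], rule suffixI[OF refl])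
      then have "suffix (sing (int k + 1)) u"
        by (rule suffix_length_suffix) (use long l1 in simp)
      with assms(2) show False
        by (simp add: sublist_append)
    next
      fix t' assume "(t @ u) @ sing (int k) = t' @ sing (int k + 2)"
      then have *: "t @ u @ sing (int k) = t' @ sing (int k + 2)" by simp
      have "suffix (sing (int k + 2)) (t @ u @ sing (int k))"
        "suffix (u @ sing (int k)) (t @ u @ sing (int k))"
        by (rule suffixI[OF *], rule suffixI[OF refl])
      then have "suffix (sing (int k + 2)) (u @ sing (int k))"
        by (rule suffix_length_suffix) (use long l2 in \<open>simp add: length_sing\<close>)
      with assms(3) show False
        using sublist_append[of _ "u @ sing (int k)" v] by simp
    qed
  qed
  show "length v < length (fib_word (Suc k))"
  proof (rule ccontr)
    assume long: "\<not> length v < length (fib_word (Suc k))"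
    from sing_right[OF tu] show False
    proof
      assume "fib_prefix ((t @ u) @ sing (int k) @ sing (int k + 1))"
      then have "prefix ((t @ u) @ sing (int k) @ sing (int k + 1)) (t @ u @ sing (int k) @ v)"
        using assms(1) by (rule fib_prefix_linear) (use long l1 in simp)
      then have "prefix (sing (int k + 1)) v" by simp
      with assms(2) show False
        by (simp add: sublist_append)
    next
      assume "fib_prefix ((t @ u) @ sing (int k + 2))"
      then have "prefix ((t @ u) @ sing (int k + 2)) (t @ u @ sing (int k) @ v)"
        using assms(1) by (rule fib_prefix_linear) (use long l2 in \<open>simp add: length_sing\<close>)
      then have "prefix (sing (int k + 2)) (sing (int k) @ v)" by simp
      with assms(3) show False
        using sublist_append[of _ u "sing (int k) @ v"] by simp
    qed
  qed
qed

text \<open>Both \<open>u\<close> and \<open>v\<close> lie within the part around \<open>s k\<close> that is the same at all its occurrences. The first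
occurrence of \<open>s k\<close> is no exception, as the forced word \<open>butlast F (k+1)\<close> precedes it as well.\<close>

lemma occurrences_of_extension:
  assumes "fib_factor (u @ sing (int k) @ v)"
    and "length u < length (fib_word (Suc k))" "length v < length (fib_word (Suc k))"
  shows "occurrences (sing (int k)) = (\<lambda>j. j + length u) ` occurrences (u @ sing (int k) @ v)"
proof (intro equalityI subsetI)
  fix i assume "i \<in> (\<lambda>j. j + length u) ` occurrences (u @ sing (int k) @ v)"
  then obtain t where "i = length (t @ u)" "fib_prefix (t @ u @ sing (int k) @ v)"
    by (auto simp: mem_occurrences_iff)
  then show "i \<in> occurrences (sing (int k))"
    using fib_prefix_appendD[of "(t @ u) @ sing (int k)" v] unfolding mem_occurrences_iff
    by (intro exI[of _ "t @ u"]) simp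
next
  fix i assume "i \<in> occurrences (sing (int k))"
  then obtain t' where t': "i = length t'" "fib_prefix (t' @ sing (int k))"
    by (auto simp: mem_occurrences_iff)
  obtain t where t: "fib_prefix (t @ u @ sing (int k) @ v)"
    using assms(1) by (auto simp: fib_factor_def mem_occurrences_iff)
  then have tu: "fib_prefix ((t @ u) @ sing (int k))"
    using fib_prefix_appendD[of "(t @ u) @ sing (int k)" v] by simp
  obtain a where a: "t @ u = a @ butlast (fib_word (Suc k))"
    using sing_left(2)[OF tu] by blast
  obtain a' where a': "t' = a' @ butlast (fib_word (Suc k))"
    using sing_left(2)[OF t'(2)] by blast
  have "suffix u (t @ u)" "suffix (butlast (fib_word (Suc k))) (t @ u)"
    by (rule suffixI[OF refl], rule suffixI[OF a])
  then have "suffix u (butlast (fib_word (Suc k)))"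
    by (rule suffix_length_suffix) (use assms(2) in \<open>simp del: fib_word_Suc'\<close>)
  then obtain b where b: "butlast (fib_word (Suc k)) = b @ u"
    by (auto simp: suffix_def)
  have "fib_prefix (t' @ sing (int k) @ v)"
    by (rule right_extension_forced[OF _ assms(3) t'(2), of "t @ u"]) (use t in simp)
  then have "fib_prefix ((a' @ b) @ u @ sing (int k) @ v)"
    by (simp add: a' b del: fib_word_Suc')
  then have "length (a' @ b) \<in> occurrences (u @ sing (int k) @ v)"
    unfolding mem_occurrences_iff by blast
  moreover have "i = length (a' @ b) + length u"
    by (simp add: t' a' b del: fib_word_Suc')
  ultimately show "i \<in> (\<lambda>j. j + length u) ` occurrences (u @ sing (int k) @ v)"
    by blast
qed

lemma sing_occurs_once:
  assumes "fib_factor w" "w = u @ sing (int k) @ v" "w = u' @ sing (int k) @ v'"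
    and "length u < length (fib_word (Suc k))" "length u' < length (fib_word (Suc k))"
  shows "u = u' \<and> v = v'"
proof -
  obtain t where t: "fib_prefix (t @ w)"
    using assms(1) by (auto simp: fib_factor_def mem_occurrences_iff)
  have 1: "fib_prefix ((t @ u) @ sing (int k))"
    using t fib_prefix_appendD[of "(t @ u) @ sing (int k)" v] assms(2) by simp
  have 2: "fib_prefix ((t @ u') @ sing (int k))"
    using t fib_prefix_appendD[of "(t @ u') @ sing (int k)" v'] assms(3) by simp
  have "length u = length u'"
    using sing_separated[OF 1 2] sing_separated[OF 2 1] assms(4,5)
    by (cases "length u" "length u'" rule: linorder_cases) auto
  then show ?thesis
    using assms(2,3) by auto
qed

section \<open>Numbering occurrences and comparing gaps\<close>

lemma enumerate_shift:
  fixes T :: "nat set"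
  assumes "infinite T"
  shows "enumerate ((\<lambda>j. j + m) ` T) n = enumerate T n + m"
proof (induction n)
  case 0
  show ?case
    unfolding enumerate_0
  proof (rule Least_equality)
    show "(LEAST j. j \<in> T) + m \<in> (\<lambda>j. j + m) ` T"
      using enumerate_in_set[OF assms, of 0] by (auto simp: enumerate_0)
  qed (auto intro: Least_le)
next
  case (Suc n)
  have "infinite ((\<lambda>j. j + m) ` T)"
    using assms by (simp add: finite_image_iff)
  then have "enumerate ((\<lambda>j. j + m) ` T) (Suc n)
      = (LEAST s. s \<in> (\<lambda>j. j + m) ` T \<and> enumerate T n + m < s)"
    by (simp only: enumerate_Suc''[OF \<open>infinite ((\<lambda>j. j + m) ` T)\<close>] Suc.IH)
  also have "\<dots> = enumerate T (Suc n) + m"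
  proof (rule Least_equality)
    show "enumerate T (Suc n) + m \<in> (\<lambda>j. j + m) ` T \<and> enumerate T n + m < enumerate T (Suc n) + m"
      unfolding add_less_cancel_right
      using enumerate_in_set[OF assms, of "Suc n"] enumerate_step[OF assms, of n] by blast
  next
    fix y assume "y \<in> (\<lambda>j. j + m) ` T \<and> enumerate T n + m < y"
    then show "enumerate T (Suc n) + m \<le> y"
      unfolding enumerate_Suc''[OF assms] by (auto intro: Least_le)
  qed
  finally show ?case .
qed

lemma block_occ: "fib_factor w \<Longrightarrow> block (occ w p) (length w) = w"
  using enumerate_in_set[OF infinite_occurrences, of w "p - 1"] by (simp add: occurrences_def occ_def)

text \<open>Going from the end of one occurrence to the start of the next amounts to going back over \<open>w\<close> and then
forward from start to start. In this form the three cases of the definition become one.\<close>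

lemma gap_eq:
  assumes "fib_factor w" "p \<ge> 1"
  shows "gap w p = inv\<^bsub>free_group\<^esub> (of_word w)
    \<otimes>\<^bsub>free_group\<^esub> of_word (block (occ w p) (occ w (p + 1) - occ w p))"
proof -
  interpret G: group "free_group :: letter signed_word monoid"
    by (rule group_free_group)
  note [simp] = of_word_carrier of_word_append
  define i j n where "i = occ w p" and "j = occ w (p + 1)" and "n = length w"
  have "i < j"
    using assms enumerate_step[OF infinite_occurrences[OF assms(1)], of "p - 1"]
    by (simp add: i_def j_def occ_def)
  have w: "block i n = w"
    unfolding i_def n_def by (rule block_occ[OF assms(1)])
  show ?thesis
  proof (cases "i + n \<le> j")
    case True
    have "gap w p = of_word (block (i + n) (j - (i + n)))"
      using True by (auto simp: gap_def Let_def i_def j_def n_def block_def of_word_def free_group_def)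
    moreover have "block i (j - i) = w @ block (i + n) (j - (i + n))"
      using True block_add[of i n "j - (i + n)"] w by simp
    ultimately show ?thesis
      unfolding i_def[symmetric] j_def[symmetric] by (simp add: G.m_assoc[symmetric])
  next
    case False
    have "gap w p = inv\<^bsub>free_group\<^esub> (of_word (block j (i + n - j)))"
      using False by (auto simp: gap_def Let_def i_def j_def n_def)
    moreover have "w = block i (j - i) @ block j (i + n - j)"
      using False \<open>i < j\<close> block_add[of i "j - i" "i + n - j"] w by simp
    then have "of_word w = of_word (block i (j - i)) \<otimes>\<^bsub>free_group\<^esub> of_word (block j (i + n - j))"
      by (metis of_word_append)
    ultimately show ?thesis
      unfolding i_def[symmetric] j_def[symmetric] by (simp add: G.inv_mult_group G.m_assoc)
  qed
qed

text \<open>Let \<open>B\<close> and \<open>C\<close> lead from one start to the next for \<open>w\<close> and for \<open>s\<close>. The path from an occurrence of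
\<open>w\<close> to the next occurrence of \<open>s\<close> can be read in two ways, \<open>u C = B u\<close>. Hence
\<open>v\<^sup>-\<^sup>1 (s\<^sup>-\<^sup>1 C) u\<^sup>-\<^sup>1 = (u s v)\<^sup>-\<^sup>1 B\<close>.\<close>

lemma gap_of_extension:
  assumes "fib_factor w" "fib_factor s" "p \<ge> 1" "w = u @ s @ v"
    and occ: "\<And>q. q \<ge> 1 \<Longrightarrow> occ w q + length u = occ s q"
  shows "gap w p = inv\<^bsub>free_group\<^esub> (of_word v) \<otimes>\<^bsub>free_group\<^esub> gap s p
          \<otimes>\<^bsub>free_group\<^esub> inv\<^bsub>free_group\<^esub> (of_word u)"
proof -
  interpret G: group "free_group :: letter signed_word monoid"
    by (rule group_free_group)
  note [simp] = of_word_carrier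
  define i j where "i = occ w p" and "j = occ w (p + 1)"
  define B C where "B = block i (j - i)" and "C = block (occ s p) (occ s (p + 1) - occ s p)"
  have "i < j"
    using assms enumerate_step[OF infinite_occurrences[OF assms(1)], of "p - 1"]
    by (simp add: i_def j_def occ_def)
  have u: "block (occ w q) (length u) = u" for q
    using block_occ[OF assms(1), of q] unfolding assms(4) by (simp add: block_add)
  have "occ s p = i + length u" "occ s (p + 1) - occ s p = j - i"
    using occ[of p] occ[of "p + 1"] assms(3) by (simp_all add: i_def j_def)
  then have "u @ C = block i (length u + (j - i))"
    using u[of p] by (simp add: C_def i_def[symmetric] block_add)
  also have "\<dots> = B @ u"
    using \<open>i < j\<close> u[of "p + 1"] block_add[of i "j - i" "length u"]
    by (simp add: B_def j_def add.commute)
  finally have "of_word u \<otimes>\<^bsub>free_group\<^esub> of_word C = of_word B \<otimes>\<^bsub>free_group\<^esub> of_word u"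
    by (metis of_word_append)
  then have "of_word C = inv\<^bsub>free_group\<^esub> (of_word u) \<otimes>\<^bsub>free_group\<^esub> (of_word B \<otimes>\<^bsub>free_group\<^esub> of_word u)"
    using G.inv_solve_left[of "of_word C" "of_word u" "of_word B \<otimes>\<^bsub>free_group\<^esub> of_word u"] by simp
  then show ?thesis
    unfolding gap_eq[OF assms(1,3)] gap_eq[OF assms(2,3)] B_def[symmetric, unfolded i_def j_def] C_def[symmetric]
    by (simp add: assms(4) of_word_append G.inv_mult_group G.m_assoc)
qed

section \<open>The singular decomposition\<close>

lemma sk_maximal:
  assumes "sublist (sing l) w" "l \<ge> -1"
  shows "length (sing l) \<le> length (sk w)"
proof -
  have "\<forall>s. s \<in> singular_words \<and> sublist s w \<longrightarrow> length s < Suc (length w)"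
    by (auto simp: less_Suc_eq_le dest: sublist_length_le)
  then show ?thesis
    unfolding sk_def using assms
    by (intro arg_max_nat_le) (auto simp: singular_words_def)
qed

text \<open>A word without \<open>s 1 = aa\<close> and \<open>s 2 = bab\<close> that contains \<open>b\<close> has at most one letter, \<open>a\<close>, on either
side of it. Since it also contains \<open>a\<close>, it is one of the excluded words.\<close>

lemma sk_eq_a_imp_a:
  assumes "fib_factor w" "w \<notin> {[], [La, Lb], [Lb, La], [La, Lb, La]}" "sk w = [La]"
  shows "w = [La]"
proof -
  have s: "sing (int 0) = [Lb]" "sing (int 0 + 1) = [La, La]" "sing (int 0 + 2) = [Lb, La, Lb]"
    unfolding sing_Suc sing_Suc_Suc sing_int by simp_all
  have no: "\<not> sublist [La, La] w" "\<not> sublist [Lb, La, Lb] w"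
    using sk_maximal[of 1 w] sk_maximal[of 2 w] s assms(3) by auto
  have a: "sublist [La] w"
    using sk_singular[of w] assms by auto
  show ?thesis
  proof (cases "Lb \<in> set w")
    case True
    then obtain u v where w: "w = u @ [Lb] @ v"
      by (metis split_list append_Cons append_Nil)
    obtain t where t: "fib_prefix (t @ w)"
      using assms(1) by (auto simp: fib_factor_def mem_occurrences_iff)
    have len: "length u < 2" "length v < 2"
      using extension_bounds[of t u 0 v] t no unfolding s w by auto
    have "u = [] \<or> u = [La]"
    proof (cases u rule: rev_cases)
      case (snoc u' c)
      with t w have "fib_prefix ((t @ u' @ [c]) @ [Lb])"
        using fib_prefix_appendD[of "t @ u' @ [c] @ [Lb]" v] by simp
      then have "c = La" by (elim before_b) auto
      with snoc len show ?thesis by simp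
    qed simp
    moreover have "v = [] \<or> v = [La]"
    proof (cases v)
      case (Cons c v')
      with t w have "fib_prefix ((t @ u) @ [Lb, c])"
        using fib_prefix_appendD[of "t @ u @ [Lb, c]" v'] by simp
      then have "c = La" by (rule after_b)
      with Cons len show ?thesis by simp
    qed simp
    ultimately show ?thesis
      using w a assms(2) by (auto simp: sublist_Cons_right)
  next
    case False
    then have "w = replicate (length w) La"
      by (metis letter.exhaust replicate_eqI)
    then obtain n where w: "w = replicate n La" by blast
    have "n < 2"
    proof (rule ccontr)
      assume "\<not> n < 2"
      then obtain m where "n = Suc (Suc m)"
        by (metis Suc_le_D not_less numeral_2_eq_2 Suc_le_mono)
      then have "w = [] @ [La, La] @ replicate m La"
        using w by simp
      with no(1) show False
        by (metis sublist_appendI)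
    qed
    then show ?thesis
      using w assms(2) by (auto simp: less_2_cases_iff)
  qed
qed

theorem theorem2p1:
  fixes \<omega> :: "letter list" and k :: int and p :: nat
  assumes "fib_factor \<omega>"
    and "\<omega> \<notin> {[], [La, Lb], [Lb, La], [La, Lb, La]}"
    and "k \<ge> -1" and "sk \<omega> = sing k"
    and "p \<ge> 1"
  shows "\<omega> = mu1 \<omega> @ sing k @ mu2 \<omega>
    \<and> (\<forall>u v. \<omega> = u @ sing k @ v \<longrightarrow> u = mu1 \<omega> \<and> v = mu2 \<omega>)
    \<and> occ \<omega> p + length (mu1 \<omega>) = occ (sing k) p
    \<and> gap \<omega> p =
        inv\<^bsub>free_group\<^esub> (of_word (mu2 \<omega>)) \<otimes>\<^bsub>free_group\<^esub> gap (sing k) p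
          \<otimes>\<^bsub>free_group\<^esub> inv\<^bsub>free_group\<^esub> (of_word (mu1 \<omega>))"
proof -
  obtain u v where w: "\<omega> = u @ sing k @ v"
    using sk_singular[of \<omega>] assms(2,4) by (auto simp: sublist_def)
  have key: "(\<forall>u' v'. \<omega> = u' @ sing k @ v' \<longrightarrow> u' = u \<and> v' = v)
    \<and> (\<forall>q. occ \<omega> q + length u = occ (sing k) q)"
  proof (cases "k = -1")
    case True
    then have s: "sing k = [La]" by (simp add: sing_def)
    have "\<omega> = [La]"
      using sk_eq_a_imp_a[OF assms(1,2)] assms(4) unfolding s by blast
    moreover from this w s have "u = []" "v = []"
      by (auto simp: append_eq_Cons_conv)
    ultimately show ?thesis
      using s by (auto simp: Cons_eq_append_conv)
  next
    case False
    with assms(3) obtain n where k: "k = int n"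
      using nonneg_int_cases[of k] by auto
    have "length (sing k) < length (sing (k + 1))" "length (sing k) < length (sing (k + 2))"
      unfolding k sing_Suc sing_Suc_Suc sing_int by simp_all
    then have no: "\<not> sublist (sing (k + 1)) \<omega>" "\<not> sublist (sing (k + 2)) \<omega>"
      using sk_maximal[of "k + 1" \<omega>] sk_maximal[of "k + 2" \<omega>] assms(3,4) by auto
    obtain t where t: "fib_prefix (t @ \<omega>)"
      using assms(1) by (auto simp: fib_factor_def mem_occurrences_iff)
    have bounds: "length u' < length (fib_word (Suc n))" "length v' < length (fib_word (Suc n))"
      if "\<omega> = u' @ sing k @ v'" for u' v'
      using extension_bounds[of t u' n v'] t no unfolding that k by auto
    have "u' = u \<and> v' = v" if "\<omega> = u' @ sing k @ v'" for u' v'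
      using sing_occurs_once[OF assms(1), of u' n v' u v] that w k
        bounds(1)[OF that] bounds(1)[OF w] by simp
    moreover have "occ \<omega> q + length u = occ (sing k) q" for q
      using occurrences_of_extension[of u n v] bounds[OF w] assms(1) w k
        enumerate_shift[OF infinite_occurrences[OF assms(1)]]
      by (simp add: occ_def)
    ultimately show ?thesis by blast
  qed
  have mu: "mu1 \<omega> = u" "mu2 \<omega> = v"
    unfolding mu1_def mu2_def assms(4) using key w by (auto intro!: the_equality)
  obtain t where "fib_prefix (t @ \<omega>)"
    using assms(1) by (auto simp: fib_factor_def mem_occurrences_iff)
  then have "fib_prefix ((t @ u) @ sing k)"
    using fib_prefix_appendD[of "(t @ u) @ sing k" v] unfolding w by simp
  then have "fib_factor (sing k)"
    unfolding fib_factor_def using mem_occurrences_iff by blast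
  then have "gap \<omega> p = inv\<^bsub>free_group\<^esub> (of_word v) \<otimes>\<^bsub>free_group\<^esub> gap (sing k) p
          \<otimes>\<^bsub>free_group\<^esub> inv\<^bsub>free_group\<^esub> (of_word u)"
    using key gap_of_extension[OF assms(1) _ assms(5) w] by blast
  with key w show ?thesis
    unfolding mu by blast
qed

end
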